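(* Let $E$ be a finite semilattice and let $G$ be a polynomially Howson group acting on the left on $E$ via the homomorphism $\theta\colon G\to \mathrm{Aut}(E)$. Then the semidirect product $E\ast_\theta G$ is polynomially Howson.
   Context: A semilattice is a (nonempty) meet-semilattice $(E,\wedge)$, and $\mathrm{Aut}(E)$ is its group of semilattice automorphisms. A left action of a group $G$ on $E$ is a group homomorphism $\theta\colon G\to\mathrm{Aut}(E)$, $g\mapsto\theta_g$; write $g\cdot e=\theta_g(e)$. The semidirect product $E\ast_\theta G$ is the set $E\times G$ with multiplication $(e,g)(f,h)=(e\wedge(g\cdot f),gh)$; it is an inverse semigroup with $(e,g)^{-1}=(g^{-1}\cdot e,g^{-1})$. For a finitely generated inverse semigroup $T$, the rank $\mathrm{rk}(T)$ is the minimum cardinality of a set $X$ generating $T$ as an inverse semigroup (for a group, this means generating it as a group); an empty intersection of inverse subsemigroups is regarded as finitely generated of rank $0$. An inverse semigroup $S$ is polynomially Howson if there exists a polynomial $p(x)\in\mathbb{R}[x]$ such that for all inverse subsemigroups $T_1,T_2$ of $S$ and all $n\in\mathbb{N}$, if $T_1,T_2$ are finitely generated with $\mathrm{rk}(T_1),\mathrm{rk}(T_2)\le n$, then $T_1\cap T_2$ is finitely generated and $\mathrm{rk}(T_1\cap T_2)\le p(n)$. A group is polynomially Howson if it is so as an inverse semigroup (its inverse subsemigroups being exactly its subgroups). *)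

theory Defs
  imports "HOL-Algebra.Bij" "HOL-Computational_Algebra.Polynomial"
begin

text \<open>
  Semigroups are given by a carrier set and a multiplication, because the \<^typ>\<open>'a monoid\<close> record
  would force a unit element that the semidirect product need not have. Inverse semigroups, and hence
  inverse subsemigroups, are nonempty.
\<close>

locale inverse_semigroup =
  fixes S :: "'a set" and mult :: "'a \<Rightarrow> 'a \<Rightarrow> 'a" (infixl \<open>\<odot>\<close> 70)
  assumes nonempty: "S \<noteq> {}"
    and closed: "\<lbrakk>x \<in> S; y \<in> S\<rbrakk> \<Longrightarrow> x \<odot> y \<in> S"
    and assoc: "\<lbrakk>x \<in> S; y \<in> S; z \<in> S\<rbrakk> \<Longrightarrow> (x \<odot> y) \<odot> z = x \<odot> (y \<odot> z)"
    and unique_inverse: "x \<in> S \<Longrightarrow> \<exists>!y. y \<in> S \<and> x \<odot> y \<odot> x = x \<and> y \<odot> x \<odot> y = y"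
begin

definition sinv :: "'a \<Rightarrow> 'a"
  where "sinv x = (THE y. y \<in> S \<and> x \<odot> y \<odot> x = x \<and> y \<odot> x \<odot> y = y)"

definition inverse_subsemigroup :: "'a set \<Rightarrow> bool"
  where "inverse_subsemigroup T \<longleftrightarrow>
    T \<noteq> {} \<and> T \<subseteq> S \<and> (\<forall>x\<in>T. \<forall>y\<in>T. x \<odot> y \<in> T) \<and> (\<forall>x\<in>T. sinv x \<in> T)"

text \<open>
  Here \<open>T\<close> is an inverse subsemigroup or the empty set. \<open>X\<close> generates \<open>T\<close> if no inverse subsemigroup properly contained in \<open>T\<close> contains \<open>X\<close>.
  Since inverse subsemigroups are nonempty, the empty set generates precisely the empty set and the
  one-element inverse subsemigroups. So an empty intersection of inverse subsemigroups has rank 0, and for a group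
  (including the trivial one, of rank 0) this is generation as a group.
\<close>

definition generates :: "'a set \<Rightarrow> 'a set \<Rightarrow> bool"
  where "generates X T \<longleftrightarrow>
    X \<subseteq> T \<and> (\<forall>U. inverse_subsemigroup U \<and> X \<subseteq> U \<and> U \<subseteq> T \<longrightarrow> U = T)"

definition finitely_generated :: "'a set \<Rightarrow> bool"
  where "finitely_generated T \<longleftrightarrow> (\<exists>X. finite X \<and> generates X T)"

text \<open>Meaningful only for finitely generated \<open>T\<close>.\<close>

definition rk :: "'a set \<Rightarrow> nat"
  where "rk T = (LEAST n. \<exists>X. finite X \<and> card X = n \<and> generates X T)"

end

locale polynomially_howson = inverse_semigroup +
  assumes polynomial_bound:
    "\<exists>p :: real poly. \<forall>T\<^sub>1 T\<^sub>2. \<forall>n :: nat.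
      inverse_subsemigroup T\<^sub>1 \<and> inverse_subsemigroup T\<^sub>2 \<and>
      finitely_generated T\<^sub>1 \<and> finitely_generated T\<^sub>2 \<and> rk T\<^sub>1 \<le> n \<and> rk T\<^sub>2 \<le> n \<longrightarrow>
      finitely_generated (T\<^sub>1 \<inter> T\<^sub>2) \<and> real (rk (T\<^sub>1 \<inter> T\<^sub>2)) \<le> poly p (real n)"

definition semilattice_AutGroup :: "('e, 'c) gorder_scheme \<Rightarrow> ('e \<Rightarrow> 'e) monoid"
  where "semilattice_AutGroup E = BijGroup (carrier E)
    \<lparr>carrier := {f \<in> Bij (carrier E).
       \<forall>x\<in>carrier E. \<forall>y\<in>carrier E. f (x \<sqinter>\<^bsub>E\<^esub> y) = f x \<sqinter>\<^bsub>E\<^esub> f y}\<rparr>"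

definition semidirect_carrier :: "('e, 'c) gorder_scheme \<Rightarrow> ('g, 'd) monoid_scheme \<Rightarrow> ('e \<times> 'g) set"
  where "semidirect_carrier E G = carrier E \<times> carrier G"

definition semidirect_mult ::
    "('e, 'c) gorder_scheme \<Rightarrow> ('g, 'd) monoid_scheme \<Rightarrow> ('g \<Rightarrow> 'e \<Rightarrow> 'e) \<Rightarrow>
     'e \<times> 'g \<Rightarrow> 'e \<times> 'g \<Rightarrow> 'e \<times> 'g"
  where "semidirect_mult E G \<theta> = (\<lambda>(e, g) (f, h). (e \<sqinter>\<^bsub>E\<^esub> \<theta> g f, g \<otimes>\<^bsub>G\<^esub> h))"

end

theory Submission
  imports Defs
begin

text \<open>
  An inverse subsemigroup \<open>T\<close> of \<open>E * G\<close> is a groupoid on finitely many objects, with \<open>(e, g)\<close> an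
  arrow from \<open>g\<inverse> \<cdot> e\<close> to \<open>e\<close>. Its vertex groups are subgroups of \<open>G\<close>, and forming them commutes with
  intersection. Schreier generators show that each vertex group has rank at most \<open>|E| rk T\<close>.
  Conversely, generators of the vertex groups together with one arrow for each pair of connected
  objects generate \<open>T\<close>. So if \<open>p\<close> is a bound for \<open>G\<close>, then \<open>|E| p(|E| n) + |E|\<^sup>2\<close> is one for \<open>E * G\<close>.
\<close>

section \<open>Generation and rank in an inverse semigroup\<close>

context inverse_semigroup
begin

lemma sinv_eqI:
  assumes "x \<in> S" "y \<in> S" "x \<odot> y \<odot> x = x" "y \<odot> x \<odot> y = y"
  shows "sinv x = y"
  unfolding sinv_def using assms unique_inverse[OF assms(1)] by (intro the1_equality) auto

lemma finitely_generatedI: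
  assumes "finite X" "generates X T"
  shows "finitely_generated T" and "rk T \<le> card X"
  using assms unfolding finitely_generated_def rk_def by (blast intro: Least_le)+

lemma finitely_generatedE:
  assumes "finitely_generated T"
  obtains X where "finite X" "generates X T" "card X = rk T"
proof -
  have "\<exists>n X. finite X \<and> card X = n \<and> generates X T"
    using assms unfolding finitely_generated_def by blast
  then have "\<exists>X. finite X \<and> card X = rk T \<and> generates X T"
    unfolding rk_def by (rule LeastI_ex)
  then show thesis
    using that by blast
qed

end

section \<open>Groups and semidirect products as inverse semigroups\<close>

lemma (in group) inverse_semigroup_group: "inverse_semigroup (carrier G) (\<otimes>)"
proof
  fix x assume x: "x \<in> carrier G"
  show "\<exists>!y. y \<in> carrier G \<and> x \<otimes> y \<otimes> x = x \<and> y \<otimes> x \<otimes> y = y"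
  proof (rule ex1I[of _ "inv x"])
    show "inv x \<in> carrier G \<and> x \<otimes> inv x \<otimes> x = x \<and> inv x \<otimes> x \<otimes> inv x = inv x"
      using x by simp
    fix y assume y: "y \<in> carrier G \<and> x \<otimes> y \<otimes> x = x \<and> y \<otimes> x \<otimes> y = y"
    then have "x \<otimes> y = \<one>"
      using x r_cancel_one by auto
    then show "y = inv x"
      using x y inv_equality inv_comm by blast
  qed
qed (auto simp: m_assoc)

text \<open>Meet and action enter as plain operations with equational laws, so the arguments below
  never touch the order record or the group of automorphisms;
  \<open>semilattice_action_of_hom\<close> provides the instance.\<close>

locale semilattice_action = group G for G (structure) +
  fixes A :: "'e set" and meet :: "'e \<Rightarrow> 'e \<Rightarrow> 'e" (infixl \<open>\<frown>\<close> 70)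
    and act :: "'a \<Rightarrow> 'e \<Rightarrow> 'e" (infixr \<open>\<cdot>\<close> 75)
  assumes A_nonempty: "A \<noteq> {}" and A_finite: "finite A"
    and meet_closed [simp]: "\<lbrakk>x \<in> A; y \<in> A\<rbrakk> \<Longrightarrow> x \<frown> y \<in> A"
    and meet_assoc: "\<lbrakk>x \<in> A; y \<in> A; z \<in> A\<rbrakk> \<Longrightarrow> x \<frown> y \<frown> z = x \<frown> (y \<frown> z)"
    and meet_comm: "\<lbrakk>x \<in> A; y \<in> A\<rbrakk> \<Longrightarrow> x \<frown> y = y \<frown> x"
    and meet_idem [simp]: "x \<in> A \<Longrightarrow> x \<frown> x = x"
    and act_closed [simp]: "\<lbrakk>g \<in> carrier G; x \<in> A\<rbrakk> \<Longrightarrow> g \<cdot> x \<in> A"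
    and act_mult: "\<lbrakk>g \<in> carrier G; h \<in> carrier G; x \<in> A\<rbrakk> \<Longrightarrow> (g \<otimes> h) \<cdot> x = g \<cdot> h \<cdot> x"
    and act_one [simp]: "x \<in> A \<Longrightarrow> \<one> \<cdot> x = x"
    and act_meet: "\<lbrakk>g \<in> carrier G; x \<in> A; y \<in> A\<rbrakk> \<Longrightarrow> g \<cdot> (x \<frown> y) = g \<cdot> x \<frown> g \<cdot> y"
begin

definition sdmult :: "'e \<times> 'a \<Rightarrow> 'e \<times> 'a \<Rightarrow> 'e \<times> 'a"
  where "sdmult = (\<lambda>(e, g) (f, h). (e \<frown> g \<cdot> f, g \<otimes> h))"

lemma sdmult_pair [simp]: "sdmult (e, g) (f, h) = (e \<frown> g \<cdot> f, g \<otimes> h)"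
  by (simp add: sdmult_def)

lemma act_inv_cancel [simp]:
  assumes "g \<in> carrier G" "x \<in> A"
  shows "inv g \<cdot> g \<cdot> x = x" and "g \<cdot> inv g \<cdot> x = x"
  using assms act_mult[of "inv g" g x] act_mult[of g "inv g" x] by simp_all

lemma act_inv_eq_iff:
  assumes "g \<in> carrier G" "x \<in> A" "y \<in> A"
  shows "inv g \<cdot> x = y \<longleftrightarrow> g \<cdot> y = x"
  using assms by auto

text \<open>The semilattice order \<open>x \<le> y\<close> is expressed as \<open>x \<frown> y = x\<close>.\<close>

lemma act_le_iff:
  assumes "g \<in> carrier G" "x \<in> A" "y \<in> A"
  shows "inv g \<cdot> x \<frown> y = inv g \<cdot> x \<longleftrightarrow> x \<frown> g \<cdot> y = x"
proof -
  have "inv g \<cdot> x \<frown> y = inv g \<cdot> (x \<frown> g \<cdot> y)"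
    using assms by (simp add: act_meet)
  moreover have "inv g \<cdot> u = inv g \<cdot> v \<longleftrightarrow> u = v" if "u \<in> A" "v \<in> A" for u v
    using assms that by (metis act_inv_cancel(2))
  ultimately show ?thesis
    using assms by simp
qed

lemma le_meetD:
  assumes "x \<frown> (y \<frown> z) = x" "x \<in> A" "y \<in> A" "z \<in> A"
  shows "x \<frown> y = x" and "x \<frown> z = x"
  by (metis assms meet_assoc meet_comm meet_closed meet_idem)+

lemma sandwich:
  assumes "e \<in> A" "g \<in> carrier G"
  shows "sdmult (sdmult (e, g) (inv g \<cdot> e, inv g)) (e, g) = (e, g)"
    and "sdmult (sdmult (inv g \<cdot> e, inv g) (e, g)) (inv g \<cdot> e, inv g) = (inv g \<cdot> e, inv g)"
  using assms by simp_all

lemma inverse_semigroup_semidirect: "inverse_semigroup (A \<times> carrier G) sdmult"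
proof
  show "A \<times> carrier G \<noteq> {}"
    using A_nonempty by auto
next
  fix x y assume "x \<in> A \<times> carrier G" "y \<in> A \<times> carrier G"
  then show "sdmult x y \<in> A \<times> carrier G"
    by auto
next
  fix x y z assume "x \<in> A \<times> carrier G" "y \<in> A \<times> carrier G" "z \<in> A \<times> carrier G"
  then show "sdmult (sdmult x y) z = sdmult x (sdmult y z)"
    by (auto simp: meet_assoc m_assoc act_meet act_mult)
next
  fix x assume "x \<in> A \<times> carrier G"
  then obtain e g where x: "x = (e, g)" and e: "e \<in> A" and g: "g \<in> carrier G"
    by auto
  show "\<exists>!y. y \<in> A \<times> carrier G \<and> sdmult (sdmult x y) x = x \<and> sdmult (sdmult y x) y = y"
  proof (rule ex1I[of _ "(inv g \<cdot> e, inv g)"])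
    show "(inv g \<cdot> e, inv g) \<in> A \<times> carrier G \<and> sdmult (sdmult x (inv g \<cdot> e, inv g)) x = x
      \<and> sdmult (sdmult (inv g \<cdot> e, inv g) x) (inv g \<cdot> e, inv g) = (inv g \<cdot> e, inv g)"
      unfolding x using e g sandwich[OF e g] by simp
    fix y assume y: "y \<in> A \<times> carrier G \<and> sdmult (sdmult x y) x = x \<and> sdmult (sdmult y x) y = y"
    then obtain f h where yd: "y = (f, h)" and f: "f \<in> A" and h: "h \<in> carrier G"
      by auto
    have "g \<otimes> h \<otimes> g = g"
      using y x yd by simp
    then have gh: "g \<otimes> h = \<one>"
      using g h r_cancel_one by auto
    then have hg: "h = inv g"
      using g h inv_equality inv_comm by blast
    \<comment> \<open>The two equations say \<open>e \<le> g \<cdot> f\<close> and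
      \<open>f \<le> inv g \<cdot> e\<close>. Applying \<open>inv g\<close> to the first gives
      \<open>inv g \<cdot> e \<le> f\<close>, so antisymmetry determines \<open>f\<close>.\<close>
    have eq: "e \<frown> g \<cdot> f \<frown> e = e" "f \<frown> inv g \<cdot> e \<frown> f = f"
      using y x yd e f g h gh hg by simp_all
    have "e \<frown> g \<cdot> f = e"
      using eq(1) e f g meet_assoc meet_comm meet_idem act_closed by metis
    then have "inv g \<cdot> e \<frown> f = inv g \<cdot> e"
      using act_le_iff e f g by simp
    moreover have "f \<frown> inv g \<cdot> e = f"
      using eq(2) e f g meet_assoc meet_comm meet_idem act_closed inv_closed by metis
    ultimately show "y = (inv g \<cdot> e, inv g)"
      using yd hg e f g meet_comm by force
  qed
qed

sublocale grp: inverse_semigroup "carrier G" "(\<otimes>)"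
  by (rule inverse_semigroup_group)

sublocale sd: inverse_semigroup "A \<times> carrier G" sdmult
  by (rule inverse_semigroup_semidirect)

lemma grp_sinv: "g \<in> carrier G \<Longrightarrow> grp.sinv g = inv g"
  by (rule grp.sinv_eqI) simp_all

lemma sd_sinv: "\<lbrakk>e \<in> A; g \<in> carrier G\<rbrakk> \<Longrightarrow> sd.sinv (e, g) = (inv g \<cdot> e, inv g)"
  by (rule sd.sinv_eqI) (use sandwich[of e g] in simp_all)

text \<open>With nonemptiness built in, closure under products and inverses is the usual subgroup
  criterion. This lets the Howson property of \<open>G\<close> be read as a statement about
  subgroups.\<close>

lemma grp_inverse_subsemigroup_iff: "grp.inverse_subsemigroup H \<longleftrightarrow> subgroup H G"
proof
  assume H: "grp.inverse_subsemigroup H"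
  show "subgroup H G"
  proof (rule subgroupI)
    show HG: "H \<subseteq> carrier G" "H \<noteq> {}"
      using H by (auto simp: grp.inverse_subsemigroup_def)
    show "inv a \<in> H" if "a \<in> H" for a
      using H that HG grp_sinv unfolding grp.inverse_subsemigroup_def by (metis subsetD)
    show "a \<otimes> b \<in> H" if "a \<in> H" "b \<in> H" for a b
      using H that unfolding grp.inverse_subsemigroup_def by blast
  qed
next
  assume "subgroup H G"
  then show "grp.inverse_subsemigroup H"
    unfolding grp.inverse_subsemigroup_def
    using subgroup.subset[of H G] subgroup.m_closed[of H G] subgroup.m_inv_closed[of H G]
      subgroup.one_closed[of H G] grp_sinv by (metis (lifting) empty_iff subsetD)
qed

lemma sd_inverse_subsemigroup_iff:
  "sd.inverse_subsemigroup T \<longleftrightarrow> T \<noteq> {} \<and> T \<subseteq> A \<times> carrier G \<and>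
    (\<forall>e g f h. (e, g) \<in> T \<longrightarrow> (f, h) \<in> T \<longrightarrow> (e \<frown> g \<cdot> f, g \<otimes> h) \<in> T) \<and>
    (\<forall>e g. (e, g) \<in> T \<longrightarrow> (inv g \<cdot> e, inv g) \<in> T)"
proof -
  have inv: "(\<forall>x\<in>T. sd.sinv x \<in> T) \<longleftrightarrow> (\<forall>e g. (e, g) \<in> T \<longrightarrow> (inv g \<cdot> e, inv g) \<in> T)"
    if "T \<subseteq> A \<times> carrier G"
  proof -
    have "sd.sinv (e, g) = (inv g \<cdot> e, inv g)" if "(e, g) \<in> T" for e g
      using \<open>T \<subseteq> A \<times> carrier G\<close> that by (intro sd_sinv) auto
    then show ?thesis
      by (simp add: Ball_def)
  qed
  have mult: "(\<forall>x\<in>T. \<forall>y\<in>T. sdmult x y \<in> T) \<longleftrightarrow>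
    (\<forall>e g f h. (e, g) \<in> T \<longrightarrow> (f, h) \<in> T \<longrightarrow> (e \<frown> g \<cdot> f, g \<otimes> h) \<in> T)"
    by (simp add: Ball_def)
  show ?thesis
    unfolding sd.inverse_subsemigroup_def mult using inv by (intro conj_cong refl) simp_all
qed

section \<open>Inverse subsemigroups as groupoids\<close>

context
  fixes T assumes T: "sd.inverse_subsemigroup T"
begin

lemma T_carrier: "(e, g) \<in> T \<Longrightarrow> e \<in> A" "(e, g) \<in> T \<Longrightarrow> g \<in> carrier G"
  using T unfolding sd_inverse_subsemigroup_iff by auto

lemma T_mult: "\<lbrakk>(e, g) \<in> T; (f, h) \<in> T\<rbrakk> \<Longrightarrow> (e \<frown> g \<cdot> f, g \<otimes> h) \<in> T"
  using T unfolding sd_inverse_subsemigroup_iff by auto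

lemma T_inv: "(e, g) \<in> T \<Longrightarrow> (inv g \<cdot> e, inv g) \<in> T"
  using T unfolding sd_inverse_subsemigroup_iff by auto

text \<open>The product of an arrow with its inverse is the identity arrow at its target.\<close>

lemma T_one:
  assumes "(e, g) \<in> T"
  shows "(e, \<one>) \<in> T"
  using T_mult[OF assms T_inv[OF assms]] T_carrier[OF assms] by simp

text \<open>Composition of arrows in the groupoid, where \<open>f\<close> may lie above the source of \<open>(e, g)\<close>.\<close>

lemma T_compose:
  assumes "(e, g) \<in> T" "(f, h) \<in> T" "inv g \<cdot> e \<frown> f = inv g \<cdot> e"
  shows "(e, g \<otimes> h) \<in> T"
  using T_mult[OF assms(1,2)] act_le_iff[of g e f] assms(3) T_carrier[OF assms(1)]
    T_carrier[OF assms(2)] by simp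

end

text \<open>The loops at \<open>e\<close>: the source \<open>inv g \<cdot> e\<close> equals
  \<open>e\<close> exactly when \<open>g\<close> fixes \<open>e\<close>. Only group components are
  kept, so vertex groups of different \<open>T\<close> can be intersected inside
  \<open>G\<close>.\<close>

definition vertex_group :: "('e \<times> 'a) set \<Rightarrow> 'e \<Rightarrow> 'a set"
  where "vertex_group T e = {g. (e, g) \<in> T \<and> g \<cdot> e = e}"

lemma vertex_group_Int: "vertex_group (T \<inter> U) e = vertex_group T e \<inter> vertex_group U e"
  by (auto simp: vertex_group_def)

text \<open>The hypothesis on \<open>e\<close> makes it an object of \<open>T\<close>, which
  supplies the identity. As loops fix \<open>e\<close>, the meet in a product of two loops collapses
  to \<open>e\<close>.\<close>

lemma subgroup_vertex_group:
  assumes T: "sd.inverse_subsemigroup T" and e: "e \<in> fst ` T"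
  shows "subgroup (vertex_group T e) G"
proof (rule subgroupI)
  show "vertex_group T e \<subseteq> carrier G"
    using T_carrier[OF T] by (auto simp: vertex_group_def)
  have "(e, \<one>) \<in> T" "e \<in> A"
    using e T_one[OF T] T_carrier[OF T] by auto
  then show "vertex_group T e \<noteq> {}"
    by (auto simp: vertex_group_def)
next
  fix g assume "g \<in> vertex_group T e"
  then show "inv g \<in> vertex_group T e"
    using T_inv[OF T, of e g] T_carrier[OF T, of e g] act_inv_eq_iff[of g e e]
    by (simp add: vertex_group_def)
next
  fix g h assume "g \<in> vertex_group T e" "h \<in> vertex_group T e"
  then show "g \<otimes> h \<in> vertex_group T e"
    using T_mult[OF T, of e g e h] T_carrier[OF T, of e g] T_carrier[OF T, of e h] act_mult[of g h e]
    by (simp add: vertex_group_def)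
qed

section \<open>Schreier generators of the vertex groups\<close>

text \<open>Schreier's argument for groupoids. A generator \<open>(f, g)\<close> of \<open>T\<close>
  acts not only as an arrow but also through its restrictions \<open>(a, g)\<close> to objects
  \<open>a \<le> f\<close>, so it contributes at most \<open>card A\<close> Schreier generators at
  \<open>e\<close>.\<close>

lemma rk_vertex_group_le:
  assumes T: "sd.inverse_subsemigroup T" and fg: "sd.finitely_generated T" and e: "e \<in> fst ` T"
  shows "grp.finitely_generated (vertex_group T e)"
    and "grp.rk (vertex_group T e) \<le> card A * sd.rk T"
proof -
  obtain X where X: "finite X" "sd.generates X T" "card X = sd.rk T"
    using fg sd.finitely_generatedE by blast
  have XT: "X \<subseteq> T"
    using X(2) by (simp add: sd.generates_def)
  have eT: "(e, \<one>) \<in> T" and eA: "e \<in> A"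
    using e T_one[OF T] T_carrier[OF T] by auto
  txt \<open>\<open>C\<close> is the connected component of \<open>e\<close>, and the arrows \<open>(e, k a)\<close> form a star-shaped spanning tree.\<close>
  define C where "C = {a. \<exists>k. (e, k) \<in> T \<and> inv k \<cdot> e = a}"
  define k where "k = (\<lambda>a. if a = e then \<one> else SOME k. (e, k) \<in> T \<and> inv k \<cdot> e = a)"
  have k: "(e, k a) \<in> T" "inv (k a) \<cdot> e = a" if "a \<in> C" for a
  proof -
    have "\<exists>k. (e, k) \<in> T \<and> inv k \<cdot> e = a"
      using that by (simp add: C_def)
    then have "(e, k a) \<in> T \<and> inv (k a) \<cdot> e = a"
      unfolding k_def using eT eA someI_ex[of "\<lambda>k. (e, k) \<in> T \<and> inv k \<cdot> e = a"] by simp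
    then show "(e, k a) \<in> T" "inv (k a) \<cdot> e = a"
      by auto
  qed
  have kG: "k a \<in> carrier G" if "a \<in> C" for a
    using k(1)[OF that] T_carrier[OF T] by blast
  have CA: "a \<in> A" if "a \<in> C" for a
    using act_closed[OF inv_closed[OF kG[OF that]] eA] k(2)[OF that] by simp
  have ka: "k a \<cdot> a = e" if "a \<in> C" for a
    using k(2)[OF that] kG[OF that] CA[OF that] eA act_inv_eq_iff by blast
  \<comment> \<open>Restricted to an object \<open>a \<le> f\<close>, \<open>(f, g)\<close> is an
    arrow from \<open>inv g \<cdot> a\<close> to \<open>a\<close>. Composed with the tree arrow from
    \<open>a\<close> it ends in \<open>e\<close>, so its source lies in \<open>C\<close>
    again.\<close>
  have step: "inv g \<cdot> a \<in> C" "(e, k a \<otimes> g) \<in> T"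
    if "(f, g) \<in> T" "a \<in> C" "a \<frown> f = a" for f g a
  proof -
    show *: "(e, k a \<otimes> g) \<in> T"
      using T_compose[OF T k(1)[OF that(2)] that(1)] k(2)[OF that(2)] that(3) by simp
    have "inv (k a \<otimes> g) \<cdot> e = inv g \<cdot> a"
      using that kG T_carrier[OF T that(1)] k(2)[OF that(2)] eA by (simp add: inv_mult_group act_mult)
    then show "inv g \<cdot> a \<in> C"
      using * unfolding C_def by blast
  qed
  \<comment> \<open>The Schreier loop at \<open>e\<close>: out along the tree to
    \<open>inv g \<cdot> a\<close>, across \<open>g\<close> to \<open>a\<close>, back along the tree
    to \<open>e\<close>.\<close>
  define s where "s = (\<lambda>a g. k a \<otimes> g \<otimes> inv (k (inv g \<cdot> a)))"
  have s_vertex: "s a g \<in> vertex_group T e" if "(f, g) \<in> T" "a \<in> C" "a \<frown> f = a" for f g a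
  proof -
    let ?b = "inv g \<cdot> a"
    note b = step(1)[OF that]
    have g: "g \<in> carrier G" and aA: "a \<in> A"
      using that CA T_carrier[OF T] by auto
    have kb: "(?b, inv (k ?b)) \<in> T"
      using T_inv[OF T k(1)[OF b]] k(2)[OF b] by simp
    have "inv (k a \<otimes> g) \<cdot> e = ?b"
      using that kG T_carrier[OF T that(1)] k(2)[OF that(2)] eA by (simp add: inv_mult_group act_mult)
    then have "(e, s a g) \<in> T"
      unfolding s_def using T_compose[OF T step(2)[OF that] kb] CA[OF b] by simp
    moreover have "s a g \<cdot> e = e"
      unfolding s_def using kG[OF that(2)] kG[OF b] g eA aA k(2)[OF b] ka[OF that(2)]
      by (simp add: act_mult)
    ultimately show ?thesis
      by (simp add: vertex_group_def)
  qed
  \<comment> \<open>\<open>f\<close> only limits which \<open>a\<close> are allowed;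
    \<open>s a g\<close> does not depend on it. The index set embeds in \<open>A \<times> X\<close>,
    whence the bound on the rank.\<close>
  define Y where "Y = (\<lambda>(a, f, g). s a g) ` {(a, f, g). (f, g) \<in> X \<and> a \<in> C \<and> a \<frown> f = a}"
  have sub: "{(a, f, g). (f, g) \<in> X \<and> a \<in> C \<and> a \<frown> f = a} \<subseteq> A \<times> X"
    using CA by auto
  have finAX: "finite (A \<times> X)"
    using A_finite X(1) by simp
  have finY: "finite Y"
    unfolding Y_def using finite_subset[OF sub finAX] by simp
  have "card Y \<le> card {(a, f, g). (f, g) \<in> X \<and> a \<in> C \<and> a \<frown> f = a}"
    unfolding Y_def using finite_subset[OF sub finAX] by (rule card_image_le)
  also have "\<dots> \<le> card (A \<times> X)"
    using card_mono[OF finAX sub] .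
  finally have cardY: "card Y \<le> card A * sd.rk T"
    using X(3) by (simp add: card_cartesian_product)
  have "grp.generates Y (vertex_group T e)"
    unfolding grp.generates_def
  proof (intro conjI allI impI)
    show "Y \<subseteq> vertex_group T e"
      unfolding Y_def using s_vertex XT by auto
  next
    fix K assume K: "grp.inverse_subsemigroup K \<and> Y \<subseteq> K \<and> K \<subseteq> vertex_group T e"
    then have Ksub: "subgroup K G"
      by (simp add: grp_inverse_subsemigroup_iff)
    txt \<open>\<open>U\<close> is an inverse subsemigroup containing \<open>X\<close>, hence equals \<open>T\<close>; since \<open>k e = \<one>\<close>, every element
      \<open>g = s e g\<close> of the vertex group then lies in \<open>K\<close>.\<close>
    define U where "U = {(f, g) \<in> T. \<forall>a\<in>C. a \<frown> f = a \<longrightarrow> s a g \<in> K}"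
    have "sd.inverse_subsemigroup U"
      unfolding sd_inverse_subsemigroup_iff
    proof (intro conjI allI impI)
      have "s a \<one> = \<one>" if "a \<in> C" for a
        unfolding s_def using kG[OF that] CA[OF that] by simp
      then have "(e, \<one>) \<in> U"
        unfolding U_def using eT subgroup.one_closed[OF Ksub] by auto
      then show "U \<noteq> {}"
        by blast
      show "U \<subseteq> A \<times> carrier G"
        unfolding U_def using T_carrier[OF T] by auto
    next
      fix f g f' g' assume fg: "(f, g) \<in> U" and fg': "(f', g') \<in> U"
      have TT: "(f, g) \<in> T" "(f', g') \<in> T"
        using fg fg' by (auto simp: U_def)
      note TC = T_carrier[OF T TT(1)] T_carrier[OF T TT(2)]
      \<comment> \<open>The condition on \<open>a\<close> splits into \<open>a \<le> f\<close> and
        \<open>inv g \<cdot> a \<le> f'\<close>. So membership in \<open>U\<close> applies to the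
        first factor at \<open>a\<close> and to the second at \<open>inv g \<cdot> a\<close>, and
        the two loops multiply.\<close>
      have "s a (g \<otimes> g') \<in> K" if a: "a \<in> C" "a \<frown> (f \<frown> g \<cdot> f') = a" for a
      proof -
        let ?b = "inv g \<cdot> a"
        have aA: "a \<in> A"
          using CA a by simp
        have le: "a \<frown> f = a" "a \<frown> g \<cdot> f' = a"
          using le_meetD[OF a(2) aA TC(1) act_closed[OF TC(2,3)]] by auto
        have leb: "?b \<frown> f' = ?b"
          using le(2) act_le_iff TC aA by simp
        have b: "?b \<in> C"
          using step(1)[OF TT(1) a(1) le(1)] .
        have c: "inv g' \<cdot> ?b \<in> C"
          using step(1)[OF TT(2) b leb] .
        have "s a g \<in> K" "s ?b g' \<in> K"
          using fg fg' a(1) b le leb by (auto simp: U_def)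
        then have "s a g \<otimes> s ?b g' \<in> K"
          using subgroup.m_closed[OF Ksub] by blast
        also have "s a g \<otimes> s ?b g' = s a (g \<otimes> g')"
        proof -
          have "inv (g \<otimes> g') \<cdot> a = inv g' \<cdot> ?b"
            using TC aA by (simp add: inv_mult_group act_mult)
          \<comment> \<open>The inner tree arrows cancel; the tail \<open>z\<close> lets the
            equation match fully right-associated products.\<close>
          moreover have "inv (k ?b) \<otimes> (k ?b \<otimes> (g' \<otimes> z)) = g' \<otimes> z" if "z \<in> carrier G" for z
            using that TC kG[OF b] by (simp add: m_assoc[symmetric])
          ultimately show ?thesis
            unfolding s_def using TC kG[OF a(1)] kG[OF b] kG[OF c] by (simp add: m_assoc)
        qed
        finally show ?thesis .
      qed
      then show "(f \<frown> g \<cdot> f', g \<otimes> g') \<in> U"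
        using T_mult[OF T TT] unfolding U_def by auto
    next
      fix f g assume fg: "(f, g) \<in> U"
      then have TT: "(f, g) \<in> T"
        by (simp add: U_def)
      note TC = T_carrier[OF T TT]
      have "s a (inv g) \<in> K" if a: "a \<in> C" "a \<frown> inv g \<cdot> f = a" for a
      proof -
        let ?b = "g \<cdot> a"
        have aA: "a \<in> A"
          using CA a by simp
        have b: "?b \<in> C"
          using step(1)[OF T_inv[OF T TT] a] TC by simp
        have leb: "?b \<frown> f = ?b"
          using act_le_iff[of "inv g" a f] a(2) TC aA by simp
        have "s ?b g \<in> K"
          using fg b leb by (auto simp: U_def)
        then have "inv (s ?b g) \<in> K"
          using subgroup.m_inv_closed[OF Ksub] by blast
        \<comment> \<open>Since \<open>inv g \<cdot> ?b = a\<close>, reversing the loop swaps the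
          tree arrows of \<open>a\<close> and \<open>?b\<close>.\<close>
        also have "inv (s ?b g) = s a (inv g)"
          unfolding s_def using TC aA kG[OF a(1)] kG[OF b] by (simp add: inv_mult_group m_assoc)
        finally show ?thesis .
      qed
      then show "(inv g \<cdot> f, inv g) \<in> U"
        using T_inv[OF T TT] unfolding U_def by auto
    qed
    moreover have "X \<subseteq> U"
      using XT K unfolding U_def Y_def by fastforce
    moreover have "U \<subseteq> T"
      by (auto simp: U_def)
    ultimately have UT: "U = T"
      using X(2) by (simp add: sd.generates_def)
    have "vertex_group T e \<subseteq> K"
    proof
      fix g assume g: "g \<in> vertex_group T e"
      then have gT: "(e, g) \<in> U" and ge: "g \<cdot> e = e"
        using UT by (auto simp: vertex_group_def)
      have gG: "g \<in> carrier G"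
        using gT UT T_carrier[OF T] by blast
      have "e \<in> C"
        using eT eA unfolding C_def by force
      then have "s e g \<in> K"
        using gT eA by (auto simp: U_def)
      moreover have "inv g \<cdot> e = e"
        using ge gG eA act_inv_eq_iff by blast
      ultimately show "g \<in> K"
        using gG by (simp add: s_def k_def)
    qed
    then show "K = vertex_group T e"
      using K by blast
  qed
  then show "grp.finitely_generated (vertex_group T e)"
    and "grp.rk (vertex_group T e) \<le> card A * sd.rk T"
    using grp.finitely_generatedI[OF finY] cardY by fastforce+
qed

section \<open>Generating an inverse subsemigroup from its vertex groups\<close>

text \<open>Two arrows with the same ends differ by a loop. So \<open>m\<close> loops at each of at
  most \<open>card A\<close> objects, and one arrow for each of at most
  \<open>(card A)\<^sup>2\<close> pairs of ends, suffice.\<close>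

lemma rk_le_vertex_groups:
  assumes T: "sd.inverse_subsemigroup T"
    and fg: "\<And>e. e \<in> fst ` T \<Longrightarrow> grp.finitely_generated (vertex_group T e)"
    and rk: "\<And>e. e \<in> fst ` T \<Longrightarrow> grp.rk (vertex_group T e) \<le> m"
  shows "sd.finitely_generated T" and "sd.rk T \<le> card A * m + (card A)\<^sup>2"
proof -
  have "\<exists>Y. finite Y \<and> grp.generates Y (vertex_group T e) \<and> card Y \<le> m" if "e \<in> fst ` T" for e
    by (rule grp.finitely_generatedE[OF fg[OF that]]) (use rk[OF that] in auto)
  then obtain Y where Y: "\<And>e. e \<in> fst ` T \<Longrightarrow>
      finite (Y e) \<and> grp.generates (Y e) (vertex_group T e) \<and> card (Y e) \<le> m"
    by metis
  \<comment> \<open>Target first, then source.\<close>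
  define ends where "ends = (\<lambda>(a, g). (a, inv g \<cdot> a))"
  have "\<forall>ab\<in>ends ` T. \<exists>t\<in>T. ends t = ab"
    by auto
  then obtain t where t: "\<And>ab. ab \<in> ends ` T \<Longrightarrow> t ab \<in> T \<and> ends (t ab) = ab"
    by metis
  have fstT: "fst ` T \<subseteq> A" and endsT: "ends ` T \<subseteq> A \<times> A"
    using T_carrier[OF T] by (fastforce simp: ends_def)+
  have finT: "finite (fst ` T)" "finite (ends ` T)"
    using finite_subset[OF fstT] finite_subset[OF endsT] A_finite by auto
  define X where "X = Sigma (fst ` T) Y \<union> t ` ends ` T"
  have finX: "finite X"
    unfolding X_def using finT Y by auto
  have "card (Sigma (fst ` T) Y) \<le> card A * m"
  proof -
    have "card (Sigma (fst ` T) Y) = (\<Sum>e\<in>fst ` T. card (Y e))"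
      using finT Y by simp
    also have "\<dots> \<le> card (fst ` T) * m"
      using sum_bounded_above[of "fst ` T" "\<lambda>e. card (Y e)" m] Y by simp
    also have "\<dots> \<le> card A * m"
      using card_mono[OF A_finite fstT] by simp
    finally show ?thesis .
  qed
  moreover have "card (t ` ends ` T) \<le> (card A)\<^sup>2"
  proof -
    have "card (t ` ends ` T) \<le> card (ends ` T)"
      by (rule card_image_le[OF finT(2)])
    also have "\<dots> \<le> card (A \<times> A)"
      using card_mono[OF _ endsT] A_finite by simp
    finally show ?thesis
      by (simp add: card_cartesian_product power2_eq_square)
  qed
  ultimately have cardX: "card X \<le> card A * m + (card A)\<^sup>2"
    unfolding X_def using card_Un_le[of "Sigma (fst ` T) Y" "t ` ends ` T"] by linarith
  have "sd.generates X T"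
    unfolding sd.generates_def
  proof (intro conjI allI impI)
    show "X \<subseteq> T"
    proof -
      have "Sigma (fst ` T) Y \<subseteq> T"
        using Y by (fastforce simp: grp.generates_def vertex_group_def)
      then show ?thesis
        unfolding X_def using t by (intro Un_least image_subsetI) simp_all
    qed
  next
    fix U assume U': "sd.inverse_subsemigroup U \<and> X \<subseteq> U \<and> U \<subseteq> T"
    then have U: "sd.inverse_subsemigroup U" and XU: "X \<subseteq> U"
      by auto
    \<comment> \<open>With \<open>k\<close> the chosen arrow having the same ends as
      \<open>g\<close>, factor \<open>g = (g \<otimes> inv k) \<otimes> k\<close>. The arrow
      \<open>(e, k)\<close> is in \<open>X\<close>, and \<open>g \<otimes> inv k\<close> is a loop
      at \<open>e\<close>.\<close>
    have "(e, g) \<in> U" if eg: "(e, g) \<in> T" for e g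
    proof -
      note C = T_carrier[OF T eg]
      have e: "e \<in> fst ` T"
        using eg by force
      have ends: "(e, inv g \<cdot> e) \<in> ends ` T"
        using eg by (force simp: ends_def)
      obtain e' k where tk: "t (e, inv g \<cdot> e) = (e', k)"
        by (rule prod.exhaust)
      have "(e', k) \<in> T \<and> ends (e', k) = (e, inv g \<cdot> e)"
        using t[OF ends] unfolding tk .
      then have k: "e' = e" "(e, k) \<in> T" "inv k \<cdot> e = inv g \<cdot> e"
        by (auto simp: ends_def)
      have "t (e, inv g \<cdot> e) \<in> X"
        unfolding X_def by (intro UnI2 imageI ends)
      then have kU: "(e, k) \<in> U"
        using XU unfolding tk k(1) by (rule subsetD[rotated])
      have kG: "k \<in> carrier G"
        using T_carrier[OF T k(2)] by simp
      have ge: "g \<cdot> inv k \<cdot> e = e"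
        using k(3) C by simp
      have "(inv k \<cdot> e, inv k) \<in> T"
        using T_inv[OF T k(2)] .
      then have "(e, g \<otimes> inv k) \<in> T"
        using T_compose[OF T eg] k(3) C by simp
      then have h: "g \<otimes> inv k \<in> vertex_group T e"
        using ge C kG by (simp add: vertex_group_def act_mult)
      \<comment> \<open>The chosen arrow makes \<open>e\<close> an object of \<open>U\<close> even
        when \<open>Y e\<close> is empty. The vertex group of \<open>U\<close> at \<open>e\<close>
        is then a subgroup between \<open>Y e\<close> and the vertex group of \<open>T\<close>, and
        generation forces equality.\<close>
      have eU: "e \<in> fst ` U"
        using kU by force
      have "vertex_group U e \<subseteq> vertex_group T e"
        using U' by (auto simp: vertex_group_def)
      moreover have "Y e \<subseteq> vertex_group U e"
      proof
        fix y assume y: "y \<in> Y e"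
        then have "(e, y) \<in> X"
          using e by (simp add: X_def)
        moreover have "y \<in> vertex_group T e"
          using Y[OF e] y by (auto simp: grp.generates_def)
        ultimately show "y \<in> vertex_group U e"
          using XU by (auto simp: vertex_group_def)
      qed
      ultimately have "vertex_group U e = vertex_group T e"
        using Y[OF e] subgroup_vertex_group[OF U eU]
        unfolding grp.generates_def grp_inverse_subsemigroup_iff by blast
      then have hU: "(e, g \<otimes> inv k) \<in> U" "(g \<otimes> inv k) \<cdot> e = e"
        using h by (auto simp: vertex_group_def)
      have "(e \<frown> (g \<otimes> inv k) \<cdot> e, g \<otimes> inv k \<otimes> k) \<in> U"
        using T_mult[OF U hU(1) kU] .
      then show ?thesis
        using hU(2) C kG by (simp add: m_assoc)
    qed
    then show "U = T"
      using U' by auto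
  qed
  then show "sd.finitely_generated T" and "sd.rk T \<le> card A * m + (card A)\<^sup>2"
    using sd.finitely_generatedI[OF finX] cardX by fastforce+
qed

section \<open>Intersections and the polynomial bound\<close>

text \<open>The vertex groups of \<open>T \<inter> U\<close> are intersections of vertex groups of
  rank at most \<open>card A * n\<close>. The number \<open>m\<close> stands for the bound that
  \<open>G\<close> gives there, so the two rank estimates combine over the naturals.\<close>

lemma rk_Int_le:
  fixes m n :: nat
  assumes m: "\<And>H K. \<lbrakk>subgroup H G; subgroup K G; grp.finitely_generated H; grp.finitely_generated K;
        grp.rk H \<le> card A * n; grp.rk K \<le> card A * n\<rbrakk>
      \<Longrightarrow> grp.finitely_generated (H \<inter> K) \<and> grp.rk (H \<inter> K) \<le> m"
    and T: "sd.inverse_subsemigroup T" "sd.finitely_generated T" "sd.rk T \<le> n"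
    and U: "sd.inverse_subsemigroup U" "sd.finitely_generated U" "sd.rk U \<le> n"
  shows "sd.finitely_generated (T \<inter> U) \<and> sd.rk (T \<inter> U) \<le> card A * m + (card A)\<^sup>2"
proof (cases "T \<inter> U = {}")
  case True
  \<comment> \<open>\<open>T\<close> and \<open>U\<close> may be disjoint; their intersection is
    then generated by the empty set and has rank 0.\<close>
  then have "sd.generates {} (T \<inter> U)"
    by (simp add: sd.generates_def)
  then show ?thesis
    using sd.finitely_generatedI[of "{}" "T \<inter> U"] by simp
next
  case False
  then have I: "sd.inverse_subsemigroup (T \<inter> U)"
    using T(1) U(1) unfolding sd.inverse_subsemigroup_def by blast
  have "grp.finitely_generated (vertex_group (T \<inter> U) e) \<and> grp.rk (vertex_group (T \<inter> U) e) \<le> m"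
    if "e \<in> fst ` (T \<inter> U)" for e
  proof -
    have e: "e \<in> fst ` T" "e \<in> fst ` U"
      using that by auto
    have "card A * sd.rk T \<le> card A * n" "card A * sd.rk U \<le> card A * n"
      using T(3) U(3) by simp_all
    then show ?thesis
      unfolding vertex_group_Int
      using m[OF subgroup_vertex_group[OF T(1) e(1)] subgroup_vertex_group[OF U(1) e(2)]]
        rk_vertex_group_le[OF T(1,2) e(1)] rk_vertex_group_le[OF U(1,2) e(2)] by linarith
  qed
  then show ?thesis
    using rk_le_vertex_groups[OF I] by blast
qed

lemma polynomially_howson_semidirect:
  assumes "polynomially_howson (carrier G) (\<otimes>)"
  shows "polynomially_howson (A \<times> carrier G) sdmult"
proof -
  obtain p :: "real poly" where p: "\<And>H K n. \<lbrakk>subgroup H G; subgroup K G; grp.finitely_generated H;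
      grp.finitely_generated K; grp.rk H \<le> n; grp.rk K \<le> n\<rbrakk>
      \<Longrightarrow> grp.finitely_generated (H \<inter> K) \<and> real (grp.rk (H \<inter> K)) \<le> poly p (real n)"
    using polynomially_howson.polynomial_bound[OF assms] unfolding grp_inverse_subsemigroup_iff
    by blast
  have "grp.generates {} {\<one>}"
    unfolding grp.generates_def grp.inverse_subsemigroup_def by blast
  then have "grp.finitely_generated {\<one>}" "grp.rk {\<one>} = 0"
    using grp.finitely_generatedI[of "{}" "{\<one>}"] by auto
  \<comment> \<open>The trivial subgroup has rank 0, so intersecting it with itself shows the bound
    to be nonnegative at every \<open>n\<close>. Hence \<open>nat\<close> applied to its floor does
    not truncate.\<close>
  then have p0: "0 \<le> poly p (real n)" for n
    using p[of "{\<one>}" "{\<one>}" n] triv_subgroup by simp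
  define c where "c = real (card A)"
  \<comment> \<open>\<open>q(x) = c p(c x) + c^2\<close>, the bound of \<open>rk_Int_le\<close> with
    \<open>p(c x)\<close> in place of \<open>m\<close>.\<close>
  define q where "q = smult c (pcompose p [:0, c:]) + [:c\<^sup>2:]"
  show ?thesis
  proof (unfold_locales, intro exI[of _ q] allI impI)
    fix T U n
    assume A: "sd.inverse_subsemigroup T \<and> sd.inverse_subsemigroup U \<and> sd.finitely_generated T \<and>
      sd.finitely_generated U \<and> sd.rk T \<le> n \<and> sd.rk U \<le> n"
    \<comment> \<open>Ranks are integers, so rounding the value of \<open>p\<close> down keeps it a
      bound.\<close>
    define m where "m = nat \<lfloor>poly p (real (card A * n))\<rfloor>"
    have m: "real m \<le> poly p (real (card A * n))"
      unfolding m_def using p0[of "card A * n"] by simp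
    have "sd.finitely_generated (T \<inter> U) \<and> sd.rk (T \<inter> U) \<le> card A * m + (card A)\<^sup>2"
    proof (rule rk_Int_le)
      fix H K
      assume "subgroup H G" "subgroup K G" "grp.finitely_generated H" "grp.finitely_generated K"
        "grp.rk H \<le> card A * n" "grp.rk K \<le> card A * n"
      from p[OF this] show "grp.finitely_generated (H \<inter> K) \<and> grp.rk (H \<inter> K) \<le> m"
        unfolding m_def by (simp add: le_nat_floor)
    qed (use A in auto)
    moreover have "real (card A * m + (card A)\<^sup>2) \<le> poly q (real n)"
      using mult_left_mono[OF m, of c]
      by (simp add: q_def c_def poly_pcompose mult.commute)
    ultimately show "sd.finitely_generated (T \<inter> U) \<and> real (sd.rk (T \<inter> U)) \<le> poly q (real n)"
      using order_trans of_nat_mono by meson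
  qed
qed

end

section \<open>From a homomorphism into the automorphism group to an action\<close>

lemma semilattice_action_of_hom:
  fixes E :: "('e, 'c) gorder_scheme" and G :: "('g, 'd) monoid_scheme"
    and \<theta> :: "'g \<Rightarrow> 'e \<Rightarrow> 'e"
  assumes "lower_semilattice E" and "carrier E \<noteq> {}" and "finite (carrier E)"
    and "group G" and \<theta>: "\<theta> \<in> hom G (semilattice_AutGroup E)"
  shows "semilattice_action G (carrier E) (meet E) \<theta>"
proof -
  interpret E: lower_semilattice E by fact
  interpret G: group G by fact
  have bij: "\<theta> g \<in> Bij (carrier E)" if "g \<in> carrier G" for g
    using hom_in_carrier[OF \<theta> that] by (simp add: semilattice_AutGroup_def)
  have meet: "\<theta> g (x \<sqinter>\<^bsub>E\<^esub> y) = \<theta> g x \<sqinter>\<^bsub>E\<^esub> \<theta> g y"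
    if "g \<in> carrier G" "x \<in> carrier E" "y \<in> carrier E" for g x y
    using hom_in_carrier[OF \<theta> that(1)] that(2,3) by (simp add: semilattice_AutGroup_def)
  have closed: "\<theta> g x \<in> carrier E" if "g \<in> carrier G" "x \<in> carrier E" for g x
    using Bij_imp_funcset[OF bij[OF that(1)]] that(2) by auto
  have mult: "\<theta> (g \<otimes>\<^bsub>G\<^esub> h) x = \<theta> g (\<theta> h x)"
    if "g \<in> carrier G" "h \<in> carrier G" "x \<in> carrier E" for g h x
    using hom_mult[OF \<theta> that(1,2)] that bij
    by (simp add: semilattice_AutGroup_def BijGroup_def compose_def)
  \<comment> \<open>The map of the unit is idempotent under composition and injective on the
    carrier, hence the identity there.\<close>
  have one: "\<theta> \<one>\<^bsub>G\<^esub> x = x" if "x \<in> carrier E" for x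
  proof -
    have "\<theta> \<one>\<^bsub>G\<^esub> (\<theta> \<one>\<^bsub>G\<^esub> x) = \<theta> \<one>\<^bsub>G\<^esub> x"
      using mult[of "\<one>\<^bsub>G\<^esub>" "\<one>\<^bsub>G\<^esub>" x] that by simp
    then show ?thesis
      using bij[of "\<one>\<^bsub>G\<^esub>"] closed[of "\<one>\<^bsub>G\<^esub>"] that
      by (auto simp: Bij_def bij_betw_def inj_on_def)
  qed
  \<comment> \<open>Associativity comes up to the equivalence of the order record, which is equality
    here.\<close>
  have assoc: "x \<sqinter>\<^bsub>E\<^esub> y \<sqinter>\<^bsub>E\<^esub> z = x \<sqinter>\<^bsub>E\<^esub> (y \<sqinter>\<^bsub>E\<^esub> z)"
    if "x \<in> carrier E" "y \<in> carrier E" "z \<in> carrier E" for x y z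
    using E.weak_meet_assoc[OF that] E.eq_is_equal by simp
  have idem: "x \<sqinter>\<^bsub>E\<^esub> x = x" if "x \<in> carrier E" for x
    using that E.meet_left[of x x] E.meet_le[of x x x] by (simp add: E.le_antisym)
  show ?thesis
    by unfold_locales
      (rule assms(2,3) E.meet_closed assoc meet_comm idem closed mult one meet; assumption)+
qed

theorem theorem3p5:
  fixes E :: "('e, 'c) gorder_scheme" and G :: "('g, 'd) monoid_scheme"
    and \<theta> :: "'g \<Rightarrow> 'e \<Rightarrow> 'e"
  assumes "lower_semilattice E" and "carrier E \<noteq> {}" and "finite (carrier E)"
    and "group G" and "polynomially_howson (carrier G) (\<otimes>\<^bsub>G\<^esub>)"
    and "\<theta> \<in> hom G (semilattice_AutGroup E)"
  shows "polynomially_howson (semidirect_carrier E G) (semidirect_mult E G \<theta>)"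
proof -
  interpret semilattice_action G "carrier E" "meet E" \<theta>
    using semilattice_action_of_hom assms by blast
  have "sdmult = semidirect_mult E G \<theta>"
    by (simp add: sdmult_def semidirect_mult_def)
  then show ?thesis
    using polynomially_howson_semidirect[OF assms(5)] by (simp add: semidirect_carrier_def)
qed

end
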